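(* Let $H=(u(x,y),v(x,y,z),h(x,y))$ be a polynomial map over $\mathbf{K}[x,y,z]$, i.e. $u,h\in\mathbf{K}[x,y]$ and $v\in\mathbf{K}[x,y,z]$. Assume that $H(0)=0$ and that the components $u,v,h$ of $H$ are linearly independent over $\mathbf{K}$. If $JH$ is nilpotent and the variety $V(Q_y)$ is irreducible for any $Q$ with $Q_y\mid\gcd(u_y,h_y)$ and $\deg_y Q\mid\gcd(\deg_y u,\deg_y h)$, then $$u=g(ay+b(x)),\qquad v=v_1z-a^{-1}b'(x)\,g(ay+b(x))-v_1l_2x,\qquad h=c_0u^2+l_2u,$$ where $b(x)=v_1c_0ax^2+l_1x+\tilde{l}_2$ for some $v_1,c_0,a\in\mathbf{K}^*$ and $l_1,l_2,\tilde{l}_2\in\mathbf{K}$, and $g(t)\in\mathbf{K}[t]$ satisfies $g(0)=0$ and $\deg_t g(t)\geq 1$.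
   Context: $\mathbf{K}$ is an algebraically closed field and $\mathbf{K}^*=\mathbf{K}\setminus\{0\}$. $JH$ denotes the $3\times 3$ Jacobian matrix of $H$ with respect to $(x,y,z)$. $Q$ denotes a polynomial in $\mathbf{K}[x,y]$. A subscript variable denotes a partial derivative, e.g. $Q_y=\partial Q/\partial y$. $\deg_y f$ is the highest degree of $y$ in $f$. For $f\in\mathbf{K}[x,y]$, $V(f)\subseteq\mathbf{K}^2$ is its zero set.
   Formalization: The field K is additionally assumed to have characteristic 0; in characteristic p the claim fails, e.g. for H = (y, z^p, x), which meets all hypotheses although v = z^p is not of the stated form. *)

theory Defs
  imports
    "Berlekamp_Zassenhaus.Unique_Factorization_Poly"
    "Jordan_Normal_Form.Matrix"
begin

text \<open>
  \<open>K[x,y]\<close> is represented as \<open>K[x][y]\<close> and \<open>K[x,y,z]\<close> as \<open>K[x][y][z]\<close>: the outermost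
  indeterminate is the last one. Hence for \<open>f\<close> in \<open>K[x,y]\<close>, the partial derivative \<open>f\<^sub>y\<close> is
  \<^term>\<open>pderiv f\<close> and \<open>deg\<^sub>y f\<close> is \<^term>\<open>degree f\<close>.
\<close>

type_synonym 'a poly_xy = "'a poly poly"
type_synonym 'a poly_xyz = "'a poly poly poly"

definition of_x :: "'a::zero poly \<Rightarrow> 'a poly_xy" where
  "of_x p = [:p:]"

definition of_xy :: "'a::zero poly_xy \<Rightarrow> 'a poly_xyz" where
  "of_xy f = [:f:]"

definition const_xy :: "'a::zero \<Rightarrow> 'a poly_xy" where
  "const_xy c = of_x [:c:]"

definition const_xyz :: "'a::zero \<Rightarrow> 'a poly_xyz" where
  "const_xyz c = of_xy (const_xy c)"

definition X_xy :: "'a::comm_semiring_1 poly_xy" where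
  "X_xy = of_x [:0, 1:]"

definition Y_xy :: "'a::comm_semiring_1 poly_xy" where
  "Y_xy = [:0, 1:]"

definition X_xyz :: "'a::comm_semiring_1 poly_xyz" where
  "X_xyz = of_xy X_xy"

definition Z_xyz :: "'a::comm_semiring_1 poly_xyz" where
  "Z_xyz = [:0, 1:]"

definition eval_xy :: "'a::comm_semiring_1 poly_xy \<Rightarrow> 'a \<Rightarrow> 'a \<Rightarrow> 'a" where
  "eval_xy f x y = poly (poly f [:y:]) x"

definition eval_xyz :: "'a::comm_semiring_1 poly_xyz \<Rightarrow> 'a \<Rightarrow> 'a \<Rightarrow> 'a \<Rightarrow> 'a" where
  "eval_xyz f x y z = eval_xy (poly f (const_xy z)) x y"

text \<open>Substitution of an element of \<open>K[x,y]\<close> into a univariate polynomial over \<open>K\<close>.\<close>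

definition subst_xy :: "'a::comm_semiring_1 poly \<Rightarrow> 'a poly_xy \<Rightarrow> 'a poly_xy" where
  "subst_xy g f = poly (map_poly const_xy g) f"

text \<open>The partial derivatives on \<open>K[x,y,z]\<close>; the indices 0, 1, 2 stand for \<open>x\<close>, \<open>y\<close>, \<open>z\<close>.\<close>

definition partial_xyz :: "nat \<Rightarrow> 'a::idom poly_xyz \<Rightarrow> 'a poly_xyz" where
  "partial_xyz i f =
     (if i = 0 then map_poly (map_poly pderiv) f
      else if i = 1 then map_poly pderiv f
      else pderiv f)"

definition jacobian_xyz :: "'a::idom poly_xyz list \<Rightarrow> 'a poly_xyz mat" where
  "jacobian_xyz H = mat (length H) 3 (\<lambda>(i, j). partial_xyz j (H ! i))"

definition nilpotent_mat :: "'a::semiring_1 mat \<Rightarrow> bool" where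
  "nilpotent_mat A \<longleftrightarrow> square_mat A \<and> (\<exists>k. A ^\<^sub>m k = 0\<^sub>m (dim_row A) (dim_row A))"

definition lin_indep_xyz :: "'a::field poly_xyz list \<Rightarrow> bool" where
  "lin_indep_xyz H \<longleftrightarrow>
     (\<forall>c :: nat \<Rightarrow> 'a. (\<Sum>i<length H. const_xyz (c i) * H ! i) = 0 \<longrightarrow> (\<forall>i<length H. c i = 0))"

definition zero_set :: "'a::comm_semiring_1 poly_xy set \<Rightarrow> ('a \<times> 'a) set" where
  "zero_set F = {(x, y). \<forall>f\<in>F. eval_xy f x y = 0}"

definition variety :: "'a::comm_semiring_1 poly_xy \<Rightarrow> ('a \<times> 'a) set" where
  "variety f = zero_set {f}"

text \<open>
  The empty set counts as irreducible. Otherwise \<open>Q = y\<close>, for which \<open>Q\<^sub>y = 1\<close> divides everything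
  and has an empty zero set, would violate any requirement that \<open>V(Q\<^sub>y)\<close> be irreducible for all
  \<open>Q\<close> with \<open>Q\<^sub>y\<close> and \<open>deg\<^sub>y Q\<close> dividing given data.
\<close>

definition irreducible_variety :: "('a::comm_semiring_1 \<times> 'a) set \<Rightarrow> bool" where
  "irreducible_variety S \<longleftrightarrow>
     (\<exists>F. S = zero_set F) \<and>
     (\<forall>F G. S = zero_set F \<union> zero_set G \<longrightarrow> S = zero_set F \<or> S = zero_set G)"

text \<open>
  The base field is taken of characteristic 0. In characteristic \<open>p > 0\<close>, \<open>H = (y, z\<^sup>p, x)\<close> has a
  nilpotent Jacobian matrix, independent components and \<open>gcd u\<^sub>y h\<^sub>y = 1\<close>, but \<open>v = z\<^sup>p\<close> is not linear
  in \<open>z\<close>.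
\<close>

text \<open>
  The type \<open>K[x,y]\<close> over an arbitrary field carries no canonical \<^const>\<open>gcd\<close> operation; since it is
  a UFD, \<^const>\<open>some_gcd\<close> picks a greatest common divisor, which is unique up to units.
\<close>

lemma dvd_some_gcd_xy_iff:
  fixes d f g :: "'a::field poly_xy"
  shows "d dvd some_gcd f g \<longleftrightarrow> d dvd f \<and> d dvd g"
  by (meson some_gcd.gcd_dvd1 some_gcd.gcd_dvd2 some_gcd.gcd_greatest dvd_trans)

end

theory Submission
  imports Defs "Jordan_Normal_Form.Char_Poly"
begin

text \<open>
  Nilpotency makes the three elementary symmetric functions of \<open>JH\<close> vanish; comparing coefficients of
  \<open>z\<close> gives \<open>v = v\<^sub>1 z + w\<close> with \<open>v\<^sub>1\<close> constant. Put \<open>k = v\<^sub>1 h\<close>, \<open>s = u\<^sub>x / u\<^sub>y\<close> and \<open>D = \<partial>\<^sub>x - s \<partial>\<^sub>y\<close> on the field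
  \<open>K(x,y)\<close>. The three equations yield \<open>D\<^sup>2 s = 0\<close>, so the level curves of \<open>u\<close> are parabolas:
  \<open>y = \<gamma> + \<beta> x + c x\<^sup>2\<close> with \<open>\<beta>, \<gamma>, c\<close> in the kernel of \<open>D\<close>. Since \<open>x\<close> is transcendental over that
  kernel, \<open>u(T, \<gamma> + \<beta> T + c T\<^sup>2)\<close> is constant in \<open>T\<close>; its leading coefficients in \<open>T\<close> show that \<open>c\<close> and
  then \<open>\<beta>\<close> are algebraic over \<open>K\<close>, hence in \<open>K\<close>. So \<open>s\<close> is a polynomial in \<open>x\<close> of degree at most 1,
  whence \<open>u = g(y + b(x))\<close> with \<open>b' = s\<close>, and the remaining components follow by integration.
\<close>

section \<open>Nilpotent matrices\<close>

text \<open>Dividing \<open>t^j I\<close> from the right by \<open>t I - A\<close> leaves the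
  remainder \<open>A^j\<close>. For \<open>j = k\<close> this vanishes, and taking determinants
  turns the matrix identity into a divisibility.\<close>

lemma char_poly_dvd_of_pow_eq_zero:
  fixes A :: "'a::comm_ring_1 mat"
  assumes A: "A \<in> carrier_mat n n" and nil: "A ^\<^sub>m k = 0\<^sub>m n n"
  shows "char_poly A dvd monom 1 k ^ n"
proof -
  define M where "M = char_poly_matrix A"
  define C where "C = map_mat (\<lambda>a::'a. [:a:])"
  have M[simp]: "M \<in> carrier_mat n n" using A by (simp add: M_def)
  have C[simp]: "C B \<in> carrier_mat n n" if "B \<in> carrier_mat n n" for B
    using that by (simp add: C_def)
  have CM: "C (B * B') = C B * C B'" if "B \<in> carrier_mat n n" "B' \<in> carrier_mat n n" for B B'
    unfolding C_def using that by (rule coeff_lift_hom.mat_hom_mult)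
  \<comment> \<open>Since \<open>M + C A\<close> is \<open>t\<close> times the identity, multiplying
    by \<open>t\<close> can be rewritten as multiplying by \<open>M + C A\<close>; this drives the
    induction below.\<close>
  have tM: "[:0,1:] \<cdot>\<^sub>m B = B * M + B * C A" if B: "B \<in> carrier_mat n n" for B
  proof -
    have "M + C A = [:0,1:] \<cdot>\<^sub>m 1\<^sub>m n"
      using A by (intro eq_matI) (auto simp: M_def C_def char_poly_matrix_def)
    hence "B * ([:0,1:] \<cdot>\<^sub>m 1\<^sub>m n) = B * M + B * C A"
      using mult_add_distrib_mat[OF B M C[OF A]] by simp
    thus ?thesis using B by (simp add: mult_smult_distrib[OF B one_carrier_mat])
  qed
  have "\<exists>B \<in> carrier_mat n n. monom 1 j \<cdot>\<^sub>m 1\<^sub>m n = B * M + C (A ^\<^sub>m j)" for j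
  proof (induction j)
    case 0
    have "monom 1 0 \<cdot>\<^sub>m 1\<^sub>m n = 0\<^sub>m n n * M + C (A ^\<^sub>m 0)"
    proof -
      have "C (1\<^sub>m n) = 1\<^sub>m n" by (simp add: C_def coeff_lift_hom.mat_hom_one)
      moreover have one: "1 \<cdot>\<^sub>m 1\<^sub>m n = (1\<^sub>m n :: 'a poly mat)" by (intro eq_matI) auto
      ultimately show ?thesis using A M by (simp add: left_mult_zero_mat[OF M] one monom_0 flip: one_pCons)
    qed
    thus ?case by (intro bexI[of _ "0\<^sub>m n n"]) simp_all
  next
    case (Suc j)
    from Suc.IH obtain B where eq: "monom 1 j \<cdot>\<^sub>m 1\<^sub>m n = B * M + C (A ^\<^sub>m j)"
      and B: "B \<in> carrier_mat n n" by (rule bexE)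
    have Aj: "A ^\<^sub>m j \<in> carrier_mat n n" using A by simp
    let ?t = "[:0,1:] :: 'a poly"
    have "monom 1 (Suc j) \<cdot>\<^sub>m 1\<^sub>m n = ?t \<cdot>\<^sub>m (monom 1 j \<cdot>\<^sub>m 1\<^sub>m n :: 'a poly mat)"
      by (intro eq_matI) (auto simp: monom_Suc)
    also have "\<dots> = (?t \<cdot>\<^sub>m B) * M + ?t \<cdot>\<^sub>m C (A ^\<^sub>m j)"
      unfolding eq
      by (subst add_smult_distrib_left_mat[where nr=n and nc=n])
        (auto simp: B Aj mult_smult_assoc_mat[OF B M] intro: mult_carrier_mat[OF B M])
    also have "\<dots> = (?t \<cdot>\<^sub>m B) * M + (C (A ^\<^sub>m j) * M + C (A ^\<^sub>m Suc j))"
      using tM[OF C[OF Aj]] CM[OF Aj A] by simp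
    also have "\<dots> = (?t \<cdot>\<^sub>m B + C (A ^\<^sub>m j)) * M + C (A ^\<^sub>m Suc j)"
      using B Aj A
      by (simp add: add_mult_distrib_mat[of _ n n _ M n] assoc_add_mat[of _ n n]
          mult_carrier_mat[of _ n n _ n])
    finally show ?case using B Aj by (intro bexI[of _ "?t \<cdot>\<^sub>m B + C (A ^\<^sub>m j)"]) auto
  qed
  then obtain B where eq: "monom 1 k \<cdot>\<^sub>m 1\<^sub>m n = B * M + C (A ^\<^sub>m k)"
    and B: "B \<in> carrier_mat n n" by (rule bexE)
  have "C (A ^\<^sub>m k) = 0\<^sub>m n n" unfolding nil by (intro eq_matI) (auto simp: C_def)
  hence "monom 1 k \<cdot>\<^sub>m 1\<^sub>m n = B * M" unfolding eq using B M by simp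
  hence "det (monom 1 k \<cdot>\<^sub>m 1\<^sub>m n) = det B * char_poly A"
    using det_mult[OF B M] by (simp add: M_def char_poly_def)
  thus ?thesis by (simp add: det_smult)
qed

text \<open>The indeterminate is prime, so it divides \<open>p\<close> or the cofactor and can be
  cancelled there; this lowers \<open>m\<close>. Monicity excludes any unit other than 1.\<close>

lemma monic_dvd_monom:
  fixes p :: "'a::idom poly"
  assumes "p dvd monom 1 m" "lead_coeff p = 1"
  shows "p = monom 1 (degree p)"
  using assms
proof (induction m arbitrary: p)
  case 0
  hence "p dvd 1" by (simp add: monom_0 flip: one_pCons)
  then obtain c where c: "p = [:c:]" by (auto simp: is_unit_poly_iff)
  thus ?case using 0 by (simp add: monom_0)
next
  case (Suc m)
  obtain q where q: "monom 1 (Suc m) = p * q" using Suc.prems(1) by (rule dvdE)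
  have [simp]: "p \<noteq> 0" using Suc.prems by auto
  have "coeff p 0 * coeff q 0 = 0"
    using arg_cong[OF q, of "\<lambda>p. coeff p 0"] by (simp add: coeff_mult_0)
  hence "coeff p 0 = 0 \<or> coeff q 0 = 0" by simp
  thus ?case
  proof
    assume "coeff q 0 = 0"
    then obtain q' where q': "q = [:0,1:] * q'" by (cases q) auto
    have "[:0,1:] * monom 1 m = [:0,1:] * (p * q')"
      using q unfolding q' monom_Suc by (simp add: algebra_simps)
    hence "p dvd monom 1 m" by (metis dvd_triv_left mult_cancel_left pCons_eq_0_iff zero_neq_one)
    thus ?case using Suc by blast
  next
    assume "coeff p 0 = 0"
    then obtain p' where p': "p = pCons 0 p'" by (cases p) auto
    have [simp]: "p' \<noteq> 0" using p' \<open>p \<noteq> 0\<close> by auto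
    have "[:0,1:] * monom 1 m = [:0,1:] * (p' * q)"
      using q unfolding p' monom_Suc by (simp add: algebra_simps)
    hence "p' dvd monom 1 m" by (metis dvd_triv_left mult_cancel_left pCons_eq_0_iff zero_neq_one)
    moreover have "lead_coeff p' = 1" using Suc.prems(2) unfolding p' by simp
    ultimately have "p' = monom 1 (degree p')" using Suc.IH by blast
    thus ?case unfolding p' by (metis monom_Suc degree_pCons_eq \<open>p' \<noteq> 0\<close>)
  qed
qed

lemma char_poly_nilpotent:
  fixes A :: "'a::idom mat"
  assumes A: "A \<in> carrier_mat n n" and "nilpotent_mat A"
  shows "char_poly A = monom 1 n"
proof -
  obtain k where "A ^\<^sub>m k = 0\<^sub>m n n" using assms by (auto simp: nilpotent_mat_def)
  hence "char_poly A dvd monom 1 (k * n)"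
    using char_poly_dvd_of_pow_eq_zero[OF A] by (simp add: monom_power)
  thus ?thesis using monic_dvd_monom degree_monic_char_poly[OF A] by metis
qed

lemma det_3:
  fixes A :: "'a::comm_ring_1 mat"
  assumes A: "A \<in> carrier_mat 3 3"
  shows "det A = A $$ (0,0) * (A $$ (1,1) * A $$ (2,2) - A $$ (1,2) * A $$ (2,1))
    - A $$ (0,1) * (A $$ (1,0) * A $$ (2,2) - A $$ (1,2) * A $$ (2,0))
    + A $$ (0,2) * (A $$ (1,0) * A $$ (2,1) - A $$ (1,1) * A $$ (2,0))"
proof -
  have det2: "det B = B $$ (0,0) * B $$ (1,1) - B $$ (0,1) * B $$ (1,0)"
    if B: "B \<in> carrier_mat 2 2" for B :: "'a mat"
    using B
    by (subst laplace_expansion_row[OF B, of 0])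
      (auto simp: numeral_2_eq_2 cofactor_def mat_delete_def det_single)
  show ?thesis
    apply (subst laplace_expansion_row[OF A, of 0])
    using A apply (simp_all add: numeral_3_eq_3 cofactor_def)
    apply (simp_all add: det2 mat_delete_def algebra_simps numeral_2_eq_2)
    done
qed

text \<open>Up to sign, the trace, the sum of the principal 2x2 minors and the determinant are the
  coefficients of \<open>t^2\<close>, \<open>t\<close> and \<open>1\<close> in the characteristic
  polynomial, which is \<open>t^3\<close> here.\<close>

lemma nilpotent_mat_3:
  fixes A :: "'a::idom mat"
  assumes A: "A \<in> carrier_mat 3 3" and nil: "nilpotent_mat A"
  shows "A $$ (0,0) + A $$ (1,1) + A $$ (2,2) = 0"
    and "A $$ (0,0) * A $$ (1,1) - A $$ (0,1) * A $$ (1,0)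
       + (A $$ (0,0) * A $$ (2,2) - A $$ (0,2) * A $$ (2,0))
       + (A $$ (1,1) * A $$ (2,2) - A $$ (1,2) * A $$ (2,1)) = 0"
    and "A $$ (0,0) * (A $$ (1,1) * A $$ (2,2) - A $$ (1,2) * A $$ (2,1))
    - A $$ (0,1) * (A $$ (1,0) * A $$ (2,2) - A $$ (1,2) * A $$ (2,0))
    + A $$ (0,2) * (A $$ (1,0) * A $$ (2,1) - A $$ (1,1) * A $$ (2,0)) = 0"
proof -
  have cp: "char_poly_matrix A $$ (i,j) = [:- A $$ (i,j), if i = j then 1 else 0:]"
    if "i < 3" "j < 3" for i j
    using A that by (auto simp: char_poly_matrix_def)
  have "det (char_poly_matrix A) = monom 1 3"
    using char_poly_nilpotent[OF A nil] by (simp add: char_poly_def)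
  note eq = this[unfolded det_3[OF char_poly_matrix_closed[OF A]], simplified cp, simplified]
  from arg_cong[OF eq, of "\<lambda>p. coeff p 2"]
  show "A $$ (0,0) + A $$ (1,1) + A $$ (2,2) = 0"
    by (simp add: numeral_2_eq_2 numeral_3_eq_3 algebra_simps neg_eq_iff_add_eq_0)
  from arg_cong[OF eq, of "\<lambda>p. coeff p 1"]
  show "A $$ (0,0) * A $$ (1,1) - A $$ (0,1) * A $$ (1,0)
       + (A $$ (0,0) * A $$ (2,2) - A $$ (0,2) * A $$ (2,0))
       + (A $$ (1,1) * A $$ (2,2) - A $$ (1,2) * A $$ (2,1)) = 0"
    by (simp add: algebra_simps)
  from arg_cong[OF eq, of "\<lambda>p. coeff p 0"]
  show "A $$ (0,0) * (A $$ (1,1) * A $$ (2,2) - A $$ (1,2) * A $$ (2,1))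
    - A $$ (0,1) * (A $$ (1,0) * A $$ (2,2) - A $$ (1,2) * A $$ (2,0))
    + A $$ (0,2) * (A $$ (1,0) * A $$ (2,1) - A $$ (1,1) * A $$ (2,0)) = 0"
    by (simp add: algebra_simps)
qed

section \<open>Derivations\<close>

locale derivation =
  fixes d :: "'a::idom \<Rightarrow> 'a"
  assumes add: "d (a + b) = d a + d b" and mult: "d (a * b) = d a * b + a * d b"
begin

lemma zero [simp]: "d 0 = 0"
proof -
  have "d 0 + d 0 = d 0 + 0" using add[of 0 0] by (simp only: add_0_right)
  thus ?thesis by (simp only: add_left_cancel)
qed

lemma one [simp]: "d 1 = 0"
proof -
  have "d 1 + d 1 = d 1 + 0" using mult[of 1 1] by (simp only: mult_1_left mult_1_right add_0_right)
  thus ?thesis by (simp only: add_left_cancel)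
qed

lemma map_poly_pCons' [simp]: "map_poly d (pCons a p) = pCons (d a) (map_poly d p)"
  by (rule Polynomial.map_poly_pCons) simp

lemma uminus: "d (- a) = - d a"
  using add[of a "- a"] by (simp add: add_eq_0_iff)

lemma diff: "d (a - b) = d a - d b"
  using add[of a "- b"] by (simp add: uminus)

lemma sum: "d (sum f A) = (\<Sum>x\<in>A. d (f x))"
  by (induction A rule: infinite_finite_induct) (auto simp: add)

lemma of_nat [simp]: "d (of_nat n) = 0"
  by (induction n) (auto simp: add)

lemma numeral [simp]: "d (numeral n) = 0"
  using of_nat[of "numeral n"] by (simp del: of_nat)

lemma poly: "d (poly p a) = poly (map_poly d p) a + poly (pderiv p) a * d a"
  for p :: "'a poly"
  by (induction p) (simp_all add: pderiv_pCons add mult algebra_simps)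

end

lemma derivation_pderiv: "derivation (pderiv :: 'a::idom poly \<Rightarrow> _)"
  by unfold_locales (auto simp: pderiv_add pderiv_mult)

lemma derivation_map_poly:
  fixes d :: "'a::idom \<Rightarrow> 'a"
  assumes "derivation d"
  shows "derivation (map_poly d)"
proof -
  interpret derivation d by fact
  show ?thesis
  proof
    fix p q
    show "map_poly d (p + q) = map_poly d p + map_poly d q"
      by (intro poly_eqI) (simp add: coeff_map_poly add)
    show "map_poly d (p * q) = map_poly d p * q + p * map_poly d q"
      by (intro poly_eqI) (simp add: coeff_map_poly coeff_mult sum mult sum.distrib)
  qed
qed

lemma derivation_pcompose:
  fixes d :: "'a::idom \<Rightarrow> 'a"
  assumes "derivation d"
  shows "map_poly d (p \<circ>\<^sub>p q) = map_poly d p \<circ>\<^sub>p q + (pderiv p \<circ>\<^sub>p q) * map_poly d q"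
proof -
  interpret derivation d by fact
  interpret m: derivation "map_poly d" using assms by (rule derivation_map_poly)
  show ?thesis
    by (induction p) (simp_all add: pderiv_pCons pcompose_pCons pcompose_add
      m.add m.mult algebra_simps)
qed

lemma map_poly_pderiv_commute: "pderiv (map_poly pderiv p) = map_poly pderiv (pderiv p)"
  for p :: "'a::idom poly poly"
  by (intro poly_eqI) (simp add: coeff_pderiv coeff_map_poly pderiv_mult flip: of_nat_Suc)

text \<open>The extension is given by the quotient rule. Independence of the chosen fraction comes
  from applying \<open>d\<close> to the cross-multiplied equality of two representatives.\<close>

lemma derivation_fract:
  fixes d :: "'a::idom \<Rightarrow> 'a"
  assumes "derivation d"
  obtains D where "derivation D" "\<And>a. D (to_fract a) = to_fract (d a)"
proof -
  interpret derivation d by fact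
  have wd: "Fraction_Field.Fract (d a * b - a * d b) (b * b)
      = Fraction_Field.Fract (d a' * b' - a' * d b') (b' * b')"
    if "b \<noteq> 0" "b' \<noteq> 0" "Fraction_Field.Fract a b = Fraction_Field.Fract a' b'" for a b a' b'
  proof -
    have 1: "a * b' = a' * b" using that by (simp add: eq_fract)
    have 2: "d a * b' + a * d b' = d a' * b + a' * d b"
      using arg_cong[OF 1, of d] by (simp add: mult)
    have "(d a * b - a * d b) * (b' * b') = (d a' * b' - a' * d b') * (b * b)"
    proof -
      \<comment> \<open>The difference is a combination of the relation 1 and its derivative
        2.\<close>
      have "(d a * b - a * d b) * (b' * b') - (d a' * b' - a' * d b') * (b * b)
        = ((d a * b' + a * d b') - (d a' * b + a' * d b)) * (b * b')
          - (a * b' - a' * b) * (d b * b' + d b' * b)"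
        by (simp add: algebra_simps)
      thus ?thesis using 1 2 by simp
    qed
    thus ?thesis using that by (simp add: eq_fract)
  qed
  define D where "D q = (let (a, b) = SOME (a, b). b \<noteq> 0 \<and> q = Fraction_Field.Fract a b
      in Fraction_Field.Fract (d a * b - a * d b) (b * b))" for q
  have D: "D (Fraction_Field.Fract a b) = Fraction_Field.Fract (d a * b - a * d b) (b * b)"
    if "b \<noteq> 0" for a b
  proof -
    define P where "P = (\<lambda>(a', b'). b' \<noteq> 0 \<and> Fraction_Field.Fract a b = Fraction_Field.Fract a' b')"
    have "P (a, b)" using that by (simp add: P_def)
    hence "P (SOME x. P x)" by (rule someI)
    thus ?thesis
      using that wd unfolding D_def P_def[symmetric]
      by (cases "SOME x. P x") (auto simp: P_def)
  qed
  show ?thesis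
  proof (rule that[of D])
    show "derivation D"
    proof
      fix q r :: "'a fract"
      obtain a b where q: "q = Fraction_Field.Fract a b" "b \<noteq> 0" by (cases q) auto
      obtain a' b' where r: "r = Fraction_Field.Fract a' b'" "b' \<noteq> 0" by (cases r) auto
      show "D (q + r) = D q + D r"
        using q r by (simp add: D eq_fract add mult algebra_simps)
      show "D (q * r) = D q * r + q * D r"
        using q r by (simp add: D eq_fract mult algebra_simps)
    qed
    show "D (to_fract a) = to_fract (d a)" for a
      by (simp add: to_fract_def D)
  qed
qed

text \<open>An element with derivative 1 is transcendental over the constants of \<open>D\<close>:
  applying \<open>D\<close> to a relation for \<open>x\<close> gives the relation with
  \<open>pderiv p\<close>, of smaller degree, and in characteristic 0 only a constant
  \<open>p\<close> has \<open>pderiv p = 0\<close>.\<close>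

lemma poly_eq_0_of_transcendental:
  fixes D :: "'a::field_char_0 \<Rightarrow> 'a"
  assumes D: "derivation D" "D x = 1" and "map_poly D p = 0" "poly p x = 0"
  shows "p = 0"
  using assms(3,4)
proof (induction "degree p" arbitrary: p rule: less_induct)
  case less
  interpret derivation D by fact
  show ?case
  proof (cases "degree p = 0")
    case True
    thus ?thesis using less.prems by (auto elim!: degree_eq_zeroE)
  next
    case False
    have "poly (pderiv p) x = 0"
      using poly[of p x] less.prems D(2) by simp
    moreover have "map_poly D (pderiv p) = 0"
    proof (intro poly_eqI)
      fix n
      have "D (coeff p (Suc n)) = 0"
        using arg_cong[OF less.prems(1), of "\<lambda>q. coeff q (Suc n)"] by (simp add: coeff_map_poly)
      thus "coeff (map_poly D (pderiv p)) n = coeff 0 n"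
        by (simp add: coeff_map_poly coeff_pderiv mult del: of_nat_Suc)
    qed
    ultimately have "pderiv p = 0" using less.hyps[of "pderiv p"] False by (simp add: degree_pderiv)
    thus ?thesis using False by (simp add: pderiv_eq_0_iff)
  qed
qed

text \<open>This makes the preceding lemma applicable to the field \<open>K(x,y)\<close>.\<close>

instance fract :: ("{idom,ring_char_0}") field_char_0
proof
  have "(of_nat n :: 'a fract) = to_fract (of_nat n)" for n by (induction n) auto
  thus "inj (of_nat :: nat \<Rightarrow> 'a fract)" by (auto simp: inj_on_def)
qed

section \<open>Polynomials that are constant along a polynomial curve\<close>

text \<open>Over an algebraically closed field \<open>p\<close> splits into linear factors, and in a
  domain \<open>x\<close> must annihilate one of them.\<close>

lemma alg_closed_root_in_range:
  fixes p :: "'a::alg_closed_field poly" and \<phi> :: "'a \<Rightarrow> 'b::idom"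
  assumes "inj_idom_hom \<phi>" "p \<noteq> 0" "poly (map_poly \<phi> p) x = 0"
  shows "x \<in> range \<phi>"
  using assms(2,3)
proof (induction "degree p" arbitrary: p rule: less_induct)
  case less
  interpret inj_idom_hom \<phi> by fact
  interpret m: map_poly_inj_idom_hom \<phi> ..
  show ?case
  proof (cases "degree p = 0")
    case True
    then obtain c where "p = [:c:]" by (rule degree_eq_zeroE)
    thus ?thesis using less.prems by (simp add: hom_distribs)
  next
    case False
    then obtain z where "poly p z = 0" using alg_closed_imp_poly_has_root by blast
    then obtain q where q: "p = [:-z, 1:] * q" by (auto simp: poly_eq_0_iff_dvd elim: dvdE)
    have "(x - \<phi> z) * poly (map_poly \<phi> q) x = 0"
      using less.prems(2) unfolding q by (simp add: hom_distribs algebra_simps)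
    moreover have "q \<noteq> 0" using less.prems(1) q by auto
    moreover have "degree q < degree p" using \<open>q \<noteq> 0\<close> unfolding q by (subst degree_mult_eq) auto
    ultimately show ?thesis using less.hyps[of q] by auto
  qed
qed

lemma coeff_mult_add_of_degree_le:
  fixes p q :: "'a::comm_semiring_0 poly"
  assumes "degree p \<le> m" "degree q \<le> n"
  shows "coeff (p * q) (m + n) = coeff p m * coeff q n"
proof (cases "degree p = m \<and> degree q = n")
  case True
  thus ?thesis using coeff_mult_degree_sum[of p q] by simp
next
  case False
  hence "degree p + degree q < m + n" using assms by linarith
  hence "degree (p * q) < m + n" using degree_mult_le[of p q] by linarith
  thus ?thesis using False assms by (auto simp: coeff_eq_0)
qed

text \<open>Give \<open>y\<close> the weight \<open>degree q\<close>: the leading coefficient of \<open>q\<close> is a root of the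
  dehomogenised top-weight form of \<open>U\<close>.\<close>

lemma lead_coeff_in_range_of_subst_const:
  fixes U :: "'a::alg_closed_field poly poly" and \<phi> :: "'a \<Rightarrow> 'b::idom"
  assumes hom: "inj_idom_hom \<phi>" and U: "\<nexists>c. U = [:[:c:]:]" and q: "degree q > 0"
    and t: "poly (map_poly (map_poly \<phi>) U) q = [:t:]"
  shows "lead_coeff q \<in> range \<phi>"
proof -
  interpret inj_idom_hom \<phi> by fact
  interpret m: map_poly_inj_idom_hom \<phi> ..
  interpret mm: map_poly_inj_idom_hom "map_poly \<phi>" ..
  define d where "d = degree q"
  define J where "J = {j. coeff U j \<noteq> 0}"
  have J: "J \<subseteq> {..degree U}" by (auto simp: J_def le_degree)
  hence fin: "finite J" by (rule finite_subset) simp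
  have J_ne: "J \<noteq> {}"
  proof
    assume "J = {}"
    hence "U = [:[:0:]:]" by (intro poly_eqI) (auto simp: J_def)
    thus False using U by blast
  qed
  \<comment> \<open>\<open>w j\<close> is the degree of the \<open>j\<close>-th summand of
    \<open>U\<close> after \<open>q\<close> is substituted for \<open>y\<close>.\<close>
  define w where "w j = degree (coeff U j) + d * j" for j
  define W where "W = Max (w ` J)"
  have w_le: "w j \<le> W" if "j \<in> J" for j using that fin by (auto simp: W_def)
  have "W \<in> w ` J" unfolding W_def using fin J_ne by (intro Max_in) auto
  then obtain j0 where j0: "j0 \<in> J" "w j0 = W" by auto
  have "W > 0"
  proof (rule ccontr)
    assume "\<not> W > 0"
    hence *: "degree (coeff U j) = 0" "j = 0" if "j \<in> J" for j
      using w_le[OF that] q by (auto simp: w_def d_def)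
    have "coeff U j = 0" if "j \<noteq> 0" for j using *(2)[of j] that by (auto simp: J_def)
    moreover have "degree (coeff U 0) = 0" using * j0(1) by metis
    then obtain c where "coeff U 0 = [:c:]" by (rule degree_eq_zeroE)
    ultimately have "U = [:[:c:]:]" by (intro poly_eqI) (simp add: coeff_pCons split: nat.splits)
    thus False using U by blast
  qed
  \<comment> \<open>The truncated subtraction is harmless: \<open>d * j \<le> W\<close> for
    \<open>j\<close> in \<open>J\<close>, and \<open>coeff U j = 0\<close> for all other
    \<open>j\<close>.\<close>
  define e where "e = (\<Sum>j\<le>degree U. monom (coeff (coeff U j) (W - d * j)) j)"
  have "coeff e j0 = lead_coeff (coeff U j0)"
  proof -
    have "W - d * j0 = degree (coeff U j0)" using j0(2) by (simp add: w_def)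
    thus ?thesis using j0(1) J by (auto simp: e_def coeff_sum)
  qed
  hence "e \<noteq> 0" using j0(1) by (auto simp: J_def)
  \<comment> \<open>Both sides are the coefficient of degree \<open>W\<close> after substitution; it
    is 0 because the result is constant and \<open>W > 0\<close>.\<close>
  moreover have "poly (map_poly \<phi> e) (lead_coeff q) = 0"
  proof -
    have "coeff (map_poly \<phi> (coeff U j) * q ^ j) W
        = \<phi> (coeff (coeff U j) (W - d * j)) * lead_coeff q ^ j" for j
    proof (cases "j \<in> J")
      case True
      have W: "W = (W - d * j) + d * j" and "degree (coeff U j) \<le> W - d * j"
        using w_le[OF True] by (auto simp: w_def)
      moreover have "q \<noteq> 0" using q by auto
      moreover have "degree (q ^ j) = d * j" using \<open>q \<noteq> 0\<close> by (simp add: degree_power_eq d_def)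
      moreover have "coeff (q ^ j) (d * j) = lead_coeff q ^ j"
        using lead_coeff_power[of q j] calculation(4) by simp
      ultimately show ?thesis
        by (subst W, subst coeff_mult_add_of_degree_le) auto
    qed (simp add: J_def)
    hence "coeff (poly (map_poly (map_poly \<phi>) U) q) W
        = (\<Sum>j\<le>degree U. \<phi> (coeff (coeff U j) (W - d * j)) * lead_coeff q ^ j)"
      by (simp add: poly_altdef coeff_sum)
    also have "\<dots> = poly (map_poly \<phi> e) (lead_coeff q)"
      by (simp add: e_def m.hom_sum poly_sum map_poly_monom poly_monom)
    finally show ?thesis using t \<open>W > 0\<close> by (simp add: coeff_pCons split: nat.splits)
  qed
  ultimately show ?thesis using alg_closed_root_in_range[OF hom] by blast
qed

text \<open>Once the leading coefficient of \<open>q\<close> is known to come from the base field,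
  the shear \<open>y -> y + c x^d\<close> moves the leading monomial of \<open>q\<close> into
  \<open>U\<close>, and induction on the degree handles the rest. It stops at degree 0, so nothing
  is said about the constant coefficient.\<close>

lemma coeff_in_range_of_subst_const:
  fixes U :: "'a::alg_closed_field poly poly" and \<phi> :: "'a \<Rightarrow> 'b::idom"
  assumes hom: "inj_idom_hom \<phi>" and "\<nexists>c. U = [:[:c:]:]"
    and "poly (map_poly (map_poly \<phi>) U) q = [:t:]" and i: "i > 0"
  shows "coeff q i \<in> range \<phi>"
  using assms(2,3)
proof (induction "degree q" arbitrary: q U rule: less_induct)
  case (less q U)
  interpret inj_idom_hom \<phi> by fact
  interpret m: map_poly_inj_idom_hom \<phi> ..
  interpret mm: map_poly_inj_idom_hom "map_poly \<phi>" ..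
  show ?case
  proof (cases "degree q = 0")
    case True
    hence "coeff q i = \<phi> 0" using i by (simp add: coeff_eq_0)
    thus ?thesis by blast
  next
    case False
    define d where "d = degree q"
    obtain c where c: "lead_coeff q = \<phi> c"
      using lead_coeff_in_range_of_subst_const[OF hom less.prems(1) _ less.prems(2)] False by auto
    define q' where "q' = q - monom (\<phi> c) d"
    define U' where "U' = U \<circ>\<^sub>p [:monom c d, 1:]"
    have "coeff q' d = 0" by (simp add: q'_def d_def flip: c)
    moreover have "degree q' \<le> d"
      unfolding q'_def by (intro degree_diff_le) (auto simp: d_def degree_monom_le)
    ultimately have "degree q' < d"
      using False by (metis d_def degree_0 leading_coeff_0_iff le_neq_implies_less)
    \<comment> \<open>The shear is invertible, so a constant \<open>U'\<close> would make
      \<open>U\<close> constant.\<close>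
    moreover have "\<nexists>c. U' = [:[:c:]:]"
    proof
      assume "\<exists>c. U' = [:[:c:]:]"
      then obtain a where "U' = [:[:a:]:]" by blast
      hence "U' \<circ>\<^sub>p [:- monom c d, 1:] = [:[:a:]:]" by simp
      moreover have "U' \<circ>\<^sub>p [:- monom c d, 1:] = U"
      proof -
        have eq: "[:monom c d, 1:] \<circ>\<^sub>p [:- monom c d, 1:] = [:0, 1:]" by simp
        show ?thesis unfolding U'_def pcompose_assoc[symmetric] eq by (rule pcompose_idR)
      qed
      ultimately show False using less.prems(1) by blast
    qed
    moreover have "poly (map_poly (map_poly \<phi>) U') q' = [:t:]"
    proof -
      have "map_poly (map_poly \<phi>) U' = map_poly (map_poly \<phi>) U \<circ>\<^sub>p [:monom (\<phi> c) d, 1:]"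
        unfolding U'_def by (simp add: m.map_poly_pcompose map_poly_monom)
      thus ?thesis using less.prems(2) by (simp add: poly_pcompose q'_def)
    qed
    ultimately have "coeff q' i \<in> range \<phi>" using less.hyps[of q' U'] by (simp add: d_def)
    moreover have "coeff q i = coeff q' i + (if i = d then \<phi> c else 0)" by (simp add: q'_def)
    ultimately show ?thesis by (auto simp: simp flip: hom_add)
  qed
qed

section \<open>The slope of the level curves\<close>

text \<open>If \<open>q(x) = y\<close>, then \<open>u(T, q(T))\<close> at \<open>T = x\<close> is
  the value of \<open>u\<close> at the generic point \<open>(x, y)\<close>, that is,
  \<open>u\<close> itself in the fraction field.\<close>

lemma eval_at_generic_point:
  assumes "poly q (to_fract [:[:0, 1:]:]) = to_fract [:0, 1:]"
  shows "poly (poly (map_poly (map_poly (\<lambda>a. to_fract [:[:a:]:])) u) q) (to_fract [:[:0, 1:]:])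
    = to_fract (u :: 'a::field poly poly)"
proof -
  have inner: "poly (map_poly (\<lambda>a. to_fract [:[:a:]:]) p) (to_fract [:[:0, 1:]:]) = to_fract [:p:]"
    for p :: "'a poly"
  proof (induction p)
    case (pCons a p)
    have "[:pCons a p:] = [:[:a:]:] + [:[:0, 1:]:] * [:p:]" by simp
    thus ?case using pCons by (simp only: to_fract_add to_fract_mult) simp
  qed simp
  show ?thesis
  proof (induction u)
    case (pCons p u)
    have "pCons p u = [:p:] + [:0, 1:] * u" by simp
    hence "to_fract (pCons p u) = to_fract [:p:] + to_fract [:0, 1:] * to_fract u"
      by (simp only: to_fract_add to_fract_mult)
    thus ?case using pCons assms inner[of p] by (simp add: Polynomial.map_poly_pCons)
  qed simp
qed

text \<open>With \<open>k = v1 h\<close> and \<open>w = v - v1 z\<close>, the hypotheses are the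
  vanishing of the determinant, of the sum of minors and of the trace. The conclusion says that all
  level curves of \<open>u\<close> are translates in the \<open>y\<close> direction of one parabola
  or line.\<close>

lemma slope_in_x:
  fixes u k w :: "'a::{alg_closed_field, field_char_0} poly poly"
  assumes uy: "pderiv u \<noteq> 0"
    and jac: "map_poly pderiv u * pderiv k = pderiv u * map_poly pderiv k"
    and minors: "map_poly pderiv u ^ 2 + pderiv u * map_poly pderiv w + pderiv k = 0"
    and trace: "pderiv w = - map_poly pderiv u"
  obtains b0 b1 where "map_poly pderiv u = [:[:b0, b1:]:] * pderiv u"
proof -
  define dx where "dx = (map_poly pderiv :: 'a poly poly \<Rightarrow> _)"
  interpret px: derivation dx
    unfolding dx_def by (intro derivation_map_poly derivation_pderiv)
  interpret py: derivation "pderiv :: 'a poly poly \<Rightarrow> _" by (rule derivation_pderiv)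
  have comm: "pderiv (dx f) = dx (pderiv f)" for f
    unfolding dx_def by (rule map_poly_pderiv_commute)
  define ux where "ux = dx u"
  define uy where "uy = pderiv u"
  define uxx where "uxx = dx ux"
  define uxy where "uxy = dx uy"
  define uyy where "uyy = pderiv uy"
  define uxyy where "uxyy = dx uyy"
  define uyyy where "uyyy = pderiv uyy"
  define kx where "kx = dx k"
  define ky where "ky = pderiv k"
  define kxy where "kxy = dx ky"
  define kyy where "kyy = pderiv ky"
  define kxyy where "kxyy = dx kyy"
  define kyyy where "kyyy = pderiv kyy"
  define wx where "wx = dx w"
  \<comment> \<open>The entry for \<open>wx\<close> is where the trace equation enters.\<close>
  have pd: "pderiv ux = uxy" "pderiv uxy = uxyy" "pderiv kx = kxy" "pderiv kxy = kxyy"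
    "pderiv wx = - uxx" "pderiv uy = uyy" "pderiv uyy = uyyy" "pderiv ky = kyy" "pderiv kyy = kyyy"
    using trace[folded dx_def]
    by (simp_all only: ux_def uy_def uxx_def uxy_def uyy_def uxyy_def uyyy_def kx_def ky_def
        kxy_def kyy_def kxyy_def kyyy_def wx_def comm px.uminus)
  have f1: "ux * ky = uy * kx"
    using jac by (simp add: ux_def uy_def kx_def ky_def dx_def)
  have f1y: "uxy * ky + ux * kyy = uyy * kx + uy * kxy"
    using arg_cong[OF f1, of pderiv] by (simp add: py.mult pd)
  have f1yy: "uxyy * ky + 2 * uxy * kyy + ux * kyyy = uyyy * kx + 2 * uyy * kxy + uy * kxyy"
    using arg_cong[OF f1y, of pderiv] by (simp add: py.mult py.add pd algebra_simps)
  have f2: "ux * ux + uy * wx + ky = 0"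
    using minors by (simp add: ux_def uy_def wx_def ky_def dx_def power2_eq_square)
  have f2y: "2 * ux * uxy + uyy * wx - uy * uxx + kyy = 0"
    using arg_cong[OF f2, of pderiv] by (simp add: py.mult py.add pd algebra_simps)

  let ?T = "to_fract :: 'a poly poly \<Rightarrow> _"
  note T = arg_cong[where f = ?T]
  have T2: "?T 2 = 2" using to_fract_add[of "1 :: 'a poly poly" 1] by simp
  note F1 = T[OF f1, simplified] and F1y = T[OF f1y, simplified]
    and F1yy = T[OF f1yy, simplified T2 to_fract_add to_fract_mult]
    and F2 = T[OF f2, simplified] and F2y = T[OF f2y, simplified T2 to_fract_add to_fract_mult to_fract_diff to_fract_0]
  have Uy: "?T uy \<noteq> 0" using assms(1) by (simp add: uy_def)
  obtain Dx where Dx: "derivation Dx" "\<And>f. Dx (?T f) = ?T (dx f)"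
    by (rule derivation_fract[OF px.derivation_axioms]) (rule that)
  obtain Dy where Dy: "derivation Dy" "\<And>f. Dy (?T f) = ?T (pderiv f)"
    by (rule derivation_fract[OF py.derivation_axioms]) (rule that)
  \<comment> \<open>The gradients of \<open>k\<close> and \<open>u\<close> are parallel, so
    \<open>k\<close> behaves like a function of \<open>u\<close>: \<open>r\<close> is its first
    derivative with respect to \<open>u\<close> and \<open>\<kappa>\<close> its second. This is why
    \<open>D\<close> kills both.\<close>
  define s where "s = ?T ux / ?T uy"
  define r where "r = ?T ky / ?T uy"
  define \<kappa> where "\<kappa> = (?T kyy - r * ?T uyy) / (?T uy)^2"
  \<comment> \<open>\<open>D\<close> differentiates along the level curves of \<open>u\<close>: it
    sends \<open>x\<close> to 1 and \<open>u\<close> to 0.\<close>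
  define D where "D q = Dx q - s * Dy q" for q
  interpret derivation D
  proof -
    interpret x: derivation Dx by fact
    interpret y: derivation Dy by fact
    show "derivation D"
      by unfold_locales (simp_all add: D_def x.add y.add x.mult y.mult algebra_simps)
  qed
  have D: "D (?T f) = ?T (dx f) - s * ?T (pderiv f)" for f
    by (simp add: D_def Dx Dy)
  have Ux: "?T ux = s * ?T uy" and Ky: "?T ky = r * ?T uy"
    using Uy by (auto simp: s_def r_def)
  have Kx: "?T kx = s * r * ?T uy" using F1 Uy unfolding Ux Ky by (simp add: algebra_simps)
  have Kyy: "?T kyy - r * ?T uyy = \<kappa> * ?T uy ^ 2" using Uy by (simp add: \<kappa>_def)
  have Kxy: "?T kxy = s * ?T kyy + r * ?T uxy - s * r * ?T uyy"
  proof -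
    have "?T uy * ?T kxy = ?T uy * (s * ?T kyy + r * ?T uxy - s * r * ?T uyy)"
      using F1y unfolding Ux Ky Kx by (simp add: algebra_simps)
    thus ?thesis using Uy by simp
  qed
  have Wx: "?T wx = - (s^2 * ?T uy + r)"
  proof -
    have "?T uy * (?T wx + (s^2 * ?T uy + r)) = 0"
      using F2 unfolding Ux Ky by (simp add: algebra_simps power2_eq_square)
    hence "?T wx + (s^2 * ?T uy + r) = 0" using Uy by simp
    thus ?thesis by (simp only: eq_neg_iff_add_eq_0)
  qed
  \<comment> \<open>Applying \<open>D\<close> to \<open>ux = s uy\<close> produces exactly the
    second-order expression that the differentiated minors equation evaluates.\<close>
  have Ds: "D s = \<kappa>"
  proof -
    have "D (s * ?T uy) = D (?T ux)" by (simp only: Ux)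
    hence 1: "D s * ?T uy = ?T uxx - 2 * s * ?T uxy + s^2 * ?T uyy"
      by (simp add: mult D pd power2_eq_square algebra_simps flip: uxx_def uxy_def)
    have 2: "?T uy * (?T uxx - 2 * s * ?T uxy + s^2 * ?T uyy) = ?T kyy - r * ?T uyy"
      using F2y unfolding Ux Wx by (simp add: algebra_simps power2_eq_square)
    have "?T uy * (D s * ?T uy) = \<kappa> * ?T uy ^ 2" by (simp only: 1 2 Kyy)
    hence "?T uy ^ 2 * D s = ?T uy ^ 2 * \<kappa>" by (simp only: power2_eq_square ac_simps)
    thus ?thesis using Uy by simp
  qed
  have Dr: "D r = 0"
  proof -
    have "D (r * ?T uy) = D (?T ky)" by (simp only: Ky)
    hence "D r * ?T uy = 0"
      using Kxy by (simp add: mult D pd algebra_simps flip: kxy_def uxy_def)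
    thus ?thesis using Uy by simp
  qed
  have D\<kappa>: "D \<kappa> = 0"
  proof -
    have "D (\<kappa> * (?T uy * ?T uy)) = D (?T kyy - r * ?T uyy)"
      by (simp only: Kyy power2_eq_square)
    hence 1: "D \<kappa> * ?T uy ^ 2 + 2 * \<kappa> * ?T uy * (?T uxy - s * ?T uyy)
      = (?T kxyy - s * ?T kyyy) - r * (?T uxyy - s * ?T uyyy)"
      by (simp add: mult diff D pd Dr power2_eq_square algebra_simps flip: kxyy_def uxy_def uxyy_def)
    have "?T uy * ((?T kxyy - s * ?T kyyy) - r * (?T uxyy - s * ?T uyyy))
      = 2 * (?T uxy - s * ?T uyy) * (?T kyy - r * ?T uyy)"
      using F1yy unfolding Ux Ky Kx Kxy by (simp add: algebra_simps)
    hence "?T uy * (D \<kappa> * ?T uy ^ 2) = 0"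
      unfolding 1[symmetric] Kyy by (simp add: algebra_simps power2_eq_square)
    thus ?thesis using Uy by simp
  qed
  define x where "x = ?T [:[:0, 1:]:]"
  define y where "y = ?T [:0, 1:]"
  have Dx1: "D x = 1" by (simp add: x_def D dx_def pderiv_pCons px.one[unfolded dx_def] flip: one_pCons)
  have Dy1: "D y = - s" by (simp add: y_def D dx_def pderiv_pCons px.one[unfolded dx_def] flip: one_pCons)
  \<comment> \<open>These values are forced: if \<open>y = \<gamma> + \<beta> x + c x^2\<close> with
    coefficients killed by \<open>D\<close>, applying \<open>D\<close> once gives
    \<open>- s = \<beta> + 2 c x\<close>, and applying it again gives
    \<open>- \<kappa> = 2 c\<close>.\<close>
  define c where "c = - \<kappa> / 2"
  define \<beta> where "\<beta> = \<kappa> * x - s"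
  define \<gamma> where "\<gamma> = y - \<beta> * x - c * x^2"
  have c: "2 * c = - \<kappa>" by (simp add: c_def)
  have "2 * D c = 0" using arg_cong[OF c, of D] by (simp add: mult uminus D\<kappa>)
  hence Dc: "D c = 0" by simp
  have D\<beta>: "D \<beta> = 0" by (simp add: \<beta>_def diff mult D\<kappa> Dx1 Ds)
  have D\<gamma>: "D \<gamma> = 0"
  proof -
    have "D \<gamma> = - s - \<beta> - (2 * c) * x"
      by (simp add: \<gamma>_def diff add mult Dc D\<beta> Dx1 Dy1 power2_eq_square algebra_simps)
    thus ?thesis by (simp add: c \<beta>_def)
  qed
  define \<phi> where "\<phi> a = ?T [:[:a:]:]" for a
  interpret \<phi>: inj_idom_hom \<phi>
    by unfold_locales (simp_all add: \<phi>_def flip: to_fract_add to_fract_mult one_pCons)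
  have D\<phi>: "D (\<phi> a) = 0" for a 
    by (simp add: \<phi>_def D dx_def pderiv_pCons derivation.map_poly_pCons'[OF derivation_pderiv])
  interpret DD: derivation "map_poly D" by (rule derivation_map_poly) (rule derivation_axioms)
  define q where "q = [:\<gamma>, \<beta>, c:]"
  define P where "P = map_poly (map_poly \<phi>) u"
  \<comment> \<open>As a polynomial in \<open>T\<close>, \<open>u(T, q(T)) - u\<close> has
    coefficients killed by \<open>D\<close> and the root \<open>T = x\<close>, which is
    transcendental over such coefficients.\<close>
  have "poly P q - [:?T u:] = 0"
  proof (rule poly_eq_0_of_transcendental)
    have "map_poly (map_poly D) P = 0"
      by (intro poly_eqI) (simp add: P_def coeff_map_poly D\<phi>)
    moreover have "map_poly D q = 0" by (simp add: q_def Dc D\<beta> D\<gamma>)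
    moreover have "D (?T u) = 0" using Ux by (simp add: D ux_def uy_def)
    ultimately show "map_poly D (poly P q - [:?T u:]) = 0"
      by (simp add: DD.diff DD.poly)
    have "poly q x = y" by (simp add: q_def \<gamma>_def power2_eq_square algebra_simps)
    hence "poly (poly P q) x = ?T u"
      using eval_at_generic_point unfolding P_def x_def y_def \<phi>_def[abs_def] by blast
    thus "poly (poly P q - [:?T u:]) x = 0" by simp
  qed (use Dx1 derivation_axioms in auto)
  hence Pq: "poly (map_poly (map_poly \<phi>) u) q = [:?T u:]" by (simp add: P_def)
  have "\<nexists>c. u = [:[:c:]:]" using assms(1) by (auto simp: pderiv_pCons)
  hence rng: "coeff q i \<in> range \<phi>" if "i > 0" for i
    using coeff_in_range_of_subst_const[OF \<phi>.inj_idom_hom_axioms _ Pq that] by blast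
  obtain c0 where c0: "c = \<phi> c0" using rng[of 2] by (auto simp: q_def numeral_2_eq_2)
  obtain \<beta>0 where \<beta>0: "\<beta> = \<phi> \<beta>0" using rng[of 1] by (auto simp: q_def)
  have "s = - \<phi> \<beta>0 - 2 * \<phi> c0 * x"
    using c0 \<beta>0 c by (simp add: \<beta>_def algebra_simps)
  also have "\<dots> = ?T (- [:[:\<beta>0:]:] - 2 * [:[:c0:]:] * [:[:0, 1:]:])"
    by (simp only: \<phi>_def x_def to_fract_diff to_fract_mult to_fract_uminus T2)
  also have "- [:[:\<beta>0:]:] - 2 * [:[:c0:]:] * [:[:0, 1:]:] = [:[:- \<beta>0, - 2 * c0:]:]"
    by (simp add: numeral_poly)
  finally have "?T ux = ?T ([:[:- \<beta>0, - 2 * c0:]:] * uy)"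
    using Ux by (simp only: to_fract_mult)
  thus ?thesis using that by (simp only: to_fract_eq_iff ux_def uy_def dx_def)
qed

section \<open>Integration of the reduced system\<close>

lemma partials_zero_imp_const_xy:
  fixes f :: "'a::field_char_0 poly poly"
  assumes "pderiv f = 0" "map_poly pderiv f = 0"
  shows "f = const_xy (eval_xy f 0 0)"
proof -
  obtain p where p: "f = [:p:]"
    using assms(1) by (auto simp: pderiv_eq_0_iff elim: degree_eq_zeroE)
  have "pderiv p = 0" using arg_cong[OF assms(2), of "\<lambda>q. coeff q 0"] by (simp add: p coeff_map_poly)
  then obtain c where "p = [:c:]" by (auto simp: pderiv_eq_0_iff elim: degree_eq_zeroE)
  thus ?thesis by (simp add: p const_xy_def of_x_def eval_xy_def)
qed

interpretation dx: derivation "map_poly pderiv :: 'a::idom poly poly \<Rightarrow> _"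
  by (intro derivation_map_poly derivation_pderiv)

interpretation dy: derivation "pderiv :: 'a::idom poly \<Rightarrow> _"
  by (rule derivation_pderiv)

lemma eval_xy_simps [simp]:
  fixes f g :: "'a::comm_ring_1 poly poly"
  shows "eval_xy (f + g) x y = eval_xy f x y + eval_xy g x y"
    "eval_xy (f - g) x y = eval_xy f x y - eval_xy g x y"
    "eval_xy (- f) x y = - eval_xy f x y"
    "eval_xy (f * g) x y = eval_xy f x y * eval_xy g x y"
    "eval_xy (f ^ n) x y = eval_xy f x y ^ n"
    "eval_xy (const_xy c) x y = c"
    "eval_xy [:p:] x y = poly p x"
    "eval_xy 0 x y = 0"
  by (simp_all add: eval_xy_def const_xy_def of_x_def poly_power)

text \<open>Comparing the mixed second derivatives of \<open>f\<close> forces the factor \<open>m\<close> to be constant.\<close>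

lemma proportional_gradients:
  fixes u f :: "'a::field_char_0 poly poly"
  assumes uy: "pderiv u \<noteq> 0" and "eval_xy u 0 0 = 0" "eval_xy f 0 0 = 0"
    and fy: "pderiv f = [:m:] * pderiv u" and fx: "map_poly pderiv f = [:m:] * map_poly pderiv u"
  obtains l where "m = [:l:]" "f = const_xy l * u"
proof -
  have "[:m:] * map_poly pderiv (pderiv u) + [:pderiv m:] * pderiv u
      = [:m:] * map_poly pderiv (pderiv u)"
    using map_poly_pderiv_commute[of f]
    unfolding fx fy dy.mult dx.mult map_poly_pderiv_commute by simp
  hence "[:pderiv m:] * pderiv u = 0" by simp
  hence "pderiv m = 0" using uy by simp
  then obtain l where l: "m = [:l:]" by (auto simp: pderiv_eq_0_iff elim: degree_eq_zeroE)
  have "f - const_xy l * u = const_xy (eval_xy (f - const_xy l * u) 0 0)"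
  proof (rule partials_zero_imp_const_xy)
    show "pderiv (f - const_xy l * u) = 0"
      unfolding dy.diff dy.mult fy l by (simp add: const_xy_def of_x_def)
    show "map_poly pderiv (f - const_xy l * u) = 0"
      unfolding dx.diff dx.mult fx l by (simp add: const_xy_def of_x_def)
  qed
  also have "eval_xy (f - const_xy l * u) 0 0 = 0" using assms(2,3) by simp
  finally have "f = const_xy l * u" by (simp add: const_xy_def of_x_def)
  thus ?thesis using that l by blast
qed

text \<open>The shear \<open>y -> y - b(x)\<close> straightens the level curves: by the chain rule
  the sheared polynomial has zero \<open>x\<close>-derivative, so its coefficients are constants and
  form \<open>g\<close>. Shearing back recovers \<open>u\<close>.\<close>

lemma exists_subst_of_slope:
  fixes u :: "'a::field_char_0 poly poly"
  assumes "map_poly pderiv u = [:pderiv b:] * pderiv u"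
  obtains g where "u = subst_xy g [:b, 1:]"
proof -
  define u' where "u' = u \<circ>\<^sub>p [:- b, 1:]"
  have dx0: "map_poly pderiv u' = 0"
    unfolding u'_def derivation_pcompose[OF derivation_pderiv] assms pcompose_mult
    by (simp add: pderiv_minus algebra_simps)
  have "pderiv (coeff u' i) = 0" for i
    using arg_cong[OF dx0, of "\<lambda>p. coeff p i"] by (simp add: coeff_map_poly)
  hence "degree (coeff u' i) = 0" for i by (simp add: pderiv_eq_0_iff)
  hence *: "[:coeff (coeff u' i) 0:] = coeff u' i" for i by (metis degree_eq_zeroE coeff_pCons_0)
  define g where "g = map_poly (\<lambda>p. coeff p 0) u'"
  have "map_poly const_xy g = map_poly (\<lambda>p. [:p:]) u'"
    by (intro poly_eqI) (simp add: g_def coeff_map_poly const_xy_def of_x_def *)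
  hence "subst_xy g [:b, 1:] = u' \<circ>\<^sub>p [:b, 1:]"
    by (simp only: subst_xy_def pcompose_altdef)
  also have "\<dots> = u"
  proof -
    have eq: "[:- b, 1:] \<circ>\<^sub>p [:b, 1:] = [:0, 1:]" by simp
    show ?thesis unfolding u'_def pcompose_assoc[symmetric] eq by (rule pcompose_idR)
  qed
  finally show ?thesis using that by metis
qed

lemma eval_xy_subst_xy:
  "eval_xy (subst_xy g f) x y = poly g (eval_xy f x (y :: 'a::comm_ring_1))"
proof (induction g)
  case 0
  show ?case by (simp add: subst_xy_def)
next
  case (pCons c g)
  have "subst_xy (pCons c g) f = const_xy c + f * subst_xy g f"
    using pCons.hyps by (simp add: subst_xy_def map_poly_pCons)
  thus ?case using pCons.IH by simp
qed

text \<open>With \<open>u_x = \<beta>(x) u_y\<close>, the trace equation makes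
  \<open>w + \<beta> u\<close> a polynomial \<open>\<omega>\<close> in \<open>x\<close> alone. The
  other two equations then give \<open>k - b1 u^2\<close> the gradient of \<open>u\<close> times
  \<open>- \<omega>'\<close>, so \<open>\<omega>'\<close> is constant; the values at the origin fix
  the integration constants.\<close>

lemma reduced_system:
  fixes u k w :: "'a::{alg_closed_field, field_char_0} poly poly"
  assumes uy: "pderiv u \<noteq> 0"
    and u0: "eval_xy u 0 0 = 0" and k0: "eval_xy k 0 0 = 0" and w0: "eval_xy w 0 0 = 0"
    and jac: "map_poly pderiv u * pderiv k = pderiv u * map_poly pderiv k"
    and minors: "map_poly pderiv u ^ 2 + pderiv u * map_poly pderiv w + pderiv k = 0"
    and trace: "pderiv w = - map_poly pderiv u"
  obtains b0 b1 l where "map_poly pderiv u = [:[:b0, 2 * b1:]:] * pderiv u"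
    "k = const_xy b1 * u ^ 2 + const_xy l * u"
    "w = - ([:[:b0, 2 * b1:]:] * u) - const_xy l * [:[:0, 1:]:]"
proof -
  obtain b0 b2 where slope: "map_poly pderiv u = [:[:b0, b2:]:] * pderiv u"
    using slope_in_x[OF uy jac minors trace] .
  \<comment> \<open>Halving makes \<open>b1\<close> the leading coefficient of the primitive of the
    slope, and the coefficient of \<open>u^2\<close> in \<open>k\<close>.\<close>
  define b1 where "b1 = b2 / 2"
  have b2: "b2 = 2 * b1" by (simp add: b1_def)
  define \<beta> where "\<beta> = [:b0, b2:]"
  define ux where "ux = map_poly pderiv u"
  define uy where "uy = pderiv u"
  note slope' = slope[folded \<beta>_def ux_def uy_def]
  have "pderiv (w + [:\<beta>:] * u) = 0"
    unfolding dy.add dy.mult trace slope by (simp add: \<beta>_def)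
  then obtain \<omega> where \<omega>: "w + [:\<beta>:] * u = [:\<omega>:]"
    by (auto simp: pderiv_eq_0_iff elim: degree_eq_zeroE)
  have d\<beta>: "pderiv \<beta> = [:b2:]" by (simp add: \<beta>_def pderiv_pCons)
  have wx: "map_poly pderiv w = [:pderiv \<omega>:] - [:[:b2:]:] * u - [:\<beta>:] * ux"
    using arg_cong[OF \<omega>, of "map_poly pderiv"]
    unfolding dx.add dx.mult by (simp add: d\<beta> ux_def algebra_simps)
  have ky: "pderiv k = uy * ([:[:b2:]:] * u - [:pderiv \<omega>:])"
  proof -
    have "pderiv k = - (ux ^ 2 + uy * map_poly pderiv w)"
      using minors unfolding ux_def uy_def eq_neg_iff_add_eq_0 by (subst add.commute)
    thus ?thesis unfolding wx by (simp add: slope' power2_eq_square algebra_simps)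
  qed
  have kx: "map_poly pderiv k = [:\<beta>:] * pderiv k"
  proof -
    have "uy * map_poly pderiv k = uy * ([:\<beta>:] * pderiv k)"
      using jac slope' by (simp only: ux_def uy_def ac_simps)
    thus ?thesis using uy by (simp only: uy_def mult_left_cancel not_False_eq_True)
  qed
  define f where "f = k - const_xy b1 * u ^ 2"
  have two: "const_xy b1 * (2 * p) = [:[:b2:]:] * p" for p :: "'a poly poly"
  proof -
    have "const_xy b1 * 2 = [:[:b2:]:]" by (simp add: b2 const_xy_def of_x_def numeral_poly)
    thus ?thesis by (simp only: mult.assoc[symmetric])
  qed
  have fy: "pderiv f = [:- pderiv \<omega>:] * pderiv u"
  proof -
    have "pderiv f = pderiv k - const_xy b1 * (2 * (u * uy))"
      unfolding f_def dy.diff dy.mult power2_eq_square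
      by (simp add: const_xy_def of_x_def uy_def algebra_simps)
    also have "\<dots> = - ([:pderiv \<omega>:] * uy)" unfolding ky two by (simp add: algebra_simps)
    finally show ?thesis by (simp add: uy_def)
  qed
  have fx: "map_poly pderiv f = [:- pderiv \<omega>:] * map_poly pderiv u"
  proof -
    have "map_poly pderiv f = [:\<beta>:] * pderiv k - const_xy b1 * (2 * (u * ux))"
      unfolding f_def dx.diff dx.mult power2_eq_square kx
      by (simp add: const_xy_def of_x_def ux_def algebra_simps)
    also have "\<dots> = - ([:pderiv \<omega>:] * ux)"
      unfolding ky two slope' by (simp add: algebra_simps)
    finally show ?thesis by (simp add: ux_def)
  qed
  have "eval_xy f 0 0 = 0" by (simp add: f_def k0 u0)
  then obtain l where l: "- pderiv \<omega> = [:l:]" "f = const_xy l * u"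
    using proportional_gradients[OF uy u0 _ fy fx] by blast
  have "pderiv (\<omega> + [:0, l:]) = 0" using l(1) by (simp add: pderiv_add pderiv_pCons add_eq_0_iff)
  then obtain c where c: "\<omega> + [:0, l:] = [:c:]" by (auto simp: pderiv_eq_0_iff elim: degree_eq_zeroE)
  have "eval_xy w 0 0 + poly \<beta> 0 * eval_xy u 0 0 = poly \<omega> 0"
    using arg_cong[OF \<omega>, of "\<lambda>p. eval_xy p 0 0"] by (simp only: eval_xy_simps)
  hence "poly \<omega> 0 = 0" using w0 u0 by simp
  hence "c = 0" using arg_cong[OF c, of "\<lambda>p. poly p 0"] by simp
  hence "\<omega> + [:0, l:] = 0" using c by simp
  hence \<omega>': "\<omega> = - [:0, l:]" by (simp only: eq_neg_iff_add_eq_0)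
  have "w = [:\<omega>:] - [:\<beta>:] * u" using \<omega> by (simp add: eq_diff_eq)
  also have "\<dots> = - ([:\<beta>:] * u) - const_xy l * [:[:0, 1:]:]"
    by (simp add: \<omega>' const_xy_def of_x_def)
  finally have "w = - ([:[:b0, 2 * b1:]:] * u) - const_xy l * [:[:0, 1:]:]"
    by (simp only: \<beta>_def b2)
  moreover have "k = const_xy b1 * u ^ 2 + const_xy l * u"
    using l(2) by (simp add: f_def algebra_simps)
  ultimately show ?thesis using that slope b2 by blast
qed

lemma lin_indep_xyz_3:
  assumes "lin_indep_xyz [f1, f2, f3]"
    and "const_xyz a * f1 + const_xyz b * f2 + const_xyz c * f3 = 0"
  shows "a = 0 \<and> b = 0 \<and> c = 0"
proof -
  have sum: "(\<Sum>i<length [f1, f2, f3]. const_xyz ([a, b, c] ! i) * [f1, f2, f3] ! i) = 0"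
    using assms(2) by (simp add: eval_nat_numeral ac_simps)
  have *: "\<forall>i<length [f1, f2, f3]. [a, b, c] ! i = 0"
    by (rule mp[OF spec[OF assms(1)[unfolded lin_indep_xyz_def], of "\<lambda>i. [a, b, c] ! i"] sum])
  have "[a, b, c] ! 0 = 0" "[a, b, c] ! 1 = 0" "[a, b, c] ! 2 = 0"
    by (rule *[rule_format], simp)+
  thus ?thesis by simp
qed

theorem theorem2p5:
  fixes u h :: "'a::{alg_closed_field, field_char_0} poly_xy"
    and v :: "'a poly_xyz"
  assumes H0: "eval_xy u 0 0 = 0" "eval_xyz v 0 0 0 = 0" "eval_xy h 0 0 = 0"
    and indep: "lin_indep_xyz [of_xy u, v, of_xy h]"
    and nilp: "nilpotent_mat (jacobian_xyz [of_xy u, v, of_xy h])"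
    and irred: "\<And>Q :: 'a poly_xy.
      pderiv Q dvd some_gcd (pderiv u) (pderiv h) \<Longrightarrow>
      degree Q dvd gcd (degree u) (degree h) \<Longrightarrow>
      irreducible_variety (variety (pderiv Q))"
  shows "\<exists>v1 c0 a l1 l2 l2' :: 'a. \<exists>b g :: 'a poly.
    v1 \<noteq> 0 \<and> c0 \<noteq> 0 \<and> a \<noteq> 0 \<and>
    b = [:l2', l1, v1 * c0 * a:] \<and>
    poly g 0 = 0 \<and> degree g \<ge> 1 \<and>
    u = subst_xy g (const_xy a * Y_xy + of_x b) \<and>
    v = const_xyz v1 * Z_xyz
        - of_xy (const_xy (inverse a) * of_x (pderiv b) * subst_xy g (const_xy a * Y_xy + of_x b))
        - const_xyz (v1 * l2) * X_xyz \<and>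
    h = const_xy c0 * u ^ 2 + const_xy l2 * u"
proof -
  define ux where "ux = map_poly pderiv u"
  define uy where "uy = pderiv u"
  define hx where "hx = map_poly pderiv h"
  define hy where "hy = pderiv h"
  define vx where "vx = map_poly (map_poly pderiv) v"
  define vy where "vy = map_poly pderiv v"
  define vz where "vz = pderiv v"
  define A where "A = jacobian_xyz [of_xy u, v, of_xy h]"
  have A: "A \<in> carrier_mat 3 3" by (simp add: A_def jacobian_xyz_def numeral_3_eq_3)
  have entries: "A $$ (0,0) = [:ux:]" "A $$ (0,1) = [:uy:]" "A $$ (0,2) = 0"
    "A $$ (1,0) = vx" "A $$ (1,1) = vy" "A $$ (1,2) = vz"
    "A $$ (2,0) = [:hx:]" "A $$ (2,1) = [:hy:]" "A $$ (2,2) = 0"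
    by (simp_all add: A_def jacobian_xyz_def partial_xyz_def of_xy_def ux_def uy_def hx_def hy_def
        vx_def vy_def vz_def Polynomial.map_poly_pCons)
  note nil = nilpotent_mat_3[OF A nilp[folded A_def], unfolded entries]
  have trace: "[:ux:] + vy = 0" using nil(1) by simp
  have minors: "[:ux:] * vy - [:uy:] * vx - vz * [:hy:] = 0" using nil(2) by simp
  \<comment> \<open>In the last column only \<open>vz\<close> can be nonzero, so the determinant
    reduces to one product.\<close>
  have det: "vz * [:ux * hy - uy * hx:] = 0"
  proof -
    have "c * (a * d - b * e) = 0"
      if "a * (p * 0 - c * d) - b * (q * 0 - c * e) + 0 * r = 0" for a b c d e p q r :: "'a poly_xyz"
      using that by (auto simp: algebra_simps)
    from this[OF nil(3)] show ?thesis by (simp add: mult.commute)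
  qed

  have dy_v: "pderiv (coeff v n) = (if n = 0 then - ux else 0)" for n
  proof -
    have "vy = - [:ux:]" using trace unfolding eq_neg_iff_add_eq_0 by (subst add.commute)
    hence "coeff vy n = coeff (- [:ux:]) n" by (rule arg_cong)
    thus ?thesis by (simp add: vy_def coeff_map_poly coeff_pCons split: nat.splits)
  qed
  \<comment> \<open>This is the coefficient of \<open>z^n\<close> in the sum of minors, with the
    sign changed; \<open>ux * vy\<close> contributes only for \<open>n = 0\<close>.\<close>
  have minors_coeff: "(if n = 0 then ux ^ 2 else 0) + uy * map_poly pderiv (coeff v n)
      + of_nat (Suc n) * coeff v (Suc n) * hy = 0" for n
  proof -
    have "ux * pderiv (coeff v n) - uy * map_poly pderiv (coeff v n)
        - of_nat (Suc n) * coeff v (Suc n) * hy = 0" (is "?m = 0")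
      using arg_cong[OF minors, of "\<lambda>p. coeff p n"]
      by (simp add: vx_def vy_def vz_def coeff_map_poly coeff_pderiv mult.commute del: of_nat_Suc)
    moreover have "(if n = 0 then ux ^ 2 else 0) + uy * map_poly pderiv (coeff v n)
      + of_nat (Suc n) * coeff v (Suc n) * hy = - ?m"
      by (simp add: dy_v power2_eq_square del: of_nat_Suc)
    ultimately show ?thesis by simp
  qed

  note lin = lin_indep_xyz_3[OF indep]
  have lin_uh: "a = 0 \<and> c = 0" if "const_xy a * u + const_xy c * h = 0" for a c
  proof -
    have "const_xyz a * of_xy u + const_xyz 0 * v + const_xyz c * of_xy h = 0"
      using that by (simp add: const_xyz_def of_xy_def const_xy_def of_x_def)
    thus ?thesis using lin by blast
  qed
  have h_neq: "h \<noteq> const_xy a * u" for a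
  proof
    assume "h = const_xy a * u"
    hence "const_xy (- a) * u + const_xy 1 * h = 0"
      by (simp add: const_xy_def of_x_def flip: smult_add_left)
    thus False using lin_uh by fastforce
  qed
  have u_neq: "u \<noteq> 0" using lin_uh[of 1 0] by (auto simp: const_xy_def of_x_def)

  \<comment> \<open>If \<open>uy = 0\<close>, the determinant makes \<open>coeff v 1\<close>,
    \<open>ux\<close> or \<open>hy\<close> vanish, and in each case the minors equation gives
    \<open>ux = 0\<close>; then \<open>u\<close> is constant, hence 0.\<close>
  have uy: "uy \<noteq> 0"
  proof
    assume uy0: "uy = 0"
    have "ux ^ 2 + coeff v 1 * hy = 0" using minors_coeff[of 0] uy0 by simp
    moreover have "coeff v 1 = 0 \<or> ux * hy = 0"
      using det uy0 by (auto simp: vz_def pderiv_eq_0_iff coeff_eq_0)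
    ultimately have "ux = 0" by auto
    hence "u = const_xy (eval_xy u 0 0)"
      using partials_zero_imp_const_xy uy0 unfolding ux_def uy_def by blast
    thus False using u_neq H0(1) by (simp add: const_xy_def of_x_def)
  qed

  \<comment> \<open>Suppose the degree in \<open>z\<close> is at least 2. Then the top coefficient
    is a constant \<open>c\<close> and the next one a polynomial \<open>p\<close> in
    \<open>x\<close>. The next minors equation makes \<open>hy\<close> a multiple of
    \<open>uy\<close> by a polynomial in \<open>x\<close>, the determinant does the same for
    \<open>hx\<close> and \<open>ux\<close>, and \<open>h\<close> becomes a constant multiple of
    \<open>u\<close>.\<close>
  have "degree v \<le> 1"
  proof (rule ccontr)
    assume "\<not> degree v \<le> 1"
    then obtain m where m: "degree v = Suc (Suc m)"
      by (metis One_nat_def Suc_le_mono le0 not0_implies_Suc nle_le)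
    let ?c = "coeff v (Suc (Suc m))" and ?p = "coeff v (Suc m)"
    have "coeff v (Suc (Suc (Suc m))) = 0" by (simp add: coeff_eq_0 m)
    hence "map_poly pderiv ?c = 0" using minors_coeff[of "Suc (Suc m)"] uy by simp
    then obtain c where c: "?c = const_xy c"
      using partials_zero_imp_const_xy[of ?c] dy_v[of "Suc (Suc m)"] by auto
    have "?c \<noteq> 0" using m by (metis leading_coeff_0_iff degree_0 nat.distinct(1))
    hence c0: "c \<noteq> 0" by (auto simp: c const_xy_def of_x_def)
    obtain p where p: "?p = [:p:]"
      using dy_v[of "Suc m"] by (auto simp: pderiv_eq_0_iff elim: degree_eq_zeroE)
    define e where "e = of_nat (Suc (Suc m)) * c"
    have e: "e \<noteq> 0" using c0 by (simp add: e_def del: of_nat_Suc)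
    have "[:pderiv p:] * uy + [:[:e:]:] * hy = 0"
      using minors_coeff[of "Suc m"] unfolding c p
      by (simp add: const_xy_def of_x_def e_def of_nat_poly mult.commute del: of_nat_Suc)
    hence "[:[:inverse e:]:] * ([:pderiv p:] * uy + [:[:e:]:] * hy) = 0" by simp
    hence hy: "hy = [:Polynomial.smult (- inverse e) (pderiv p):] * uy"
      using e by (simp add: smult_add_right eq_neg_iff_add_eq_0 add.commute)
    have "vz \<noteq> 0" using m by (simp add: vz_def pderiv_eq_0_iff)
    hence "uy * hx = uy * ([:Polynomial.smult (- inverse e) (pderiv p):] * ux)"
      using det unfolding hy by (simp add: ac_simps)
    hence hx: "hx = [:Polynomial.smult (- inverse e) (pderiv p):] * ux"
      using uy by (simp only: mult_left_cancel not_False_eq_True)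
    show False
      using proportional_gradients[OF uy[unfolded uy_def] H0(1,3) hy[unfolded hy_def uy_def]
          hx[unfolded hx_def ux_def]] h_neq by metis
  qed
  define w where "w = coeff v 0"
  have v2: "coeff v (Suc (Suc n)) = 0" for n using \<open>degree v \<le> 1\<close> by (simp add: coeff_eq_0)
  have "map_poly pderiv (coeff v 1) = 0" using minors_coeff[of 1] v2[of 0] uy by simp
  then obtain v1 where v1: "coeff v 1 = const_xy v1"
    using partials_zero_imp_const_xy[of "coeff v 1"] dy_v[of 1] by auto
  have v: "v = [:w, const_xy v1:]"
    by (intro poly_eqI) (auto simp: w_def coeff_pCons v2 v1[simplified] split: nat.splits)
  have w0: "eval_xy w 0 0 = 0"
    using H0(2) by (simp add: v eval_xyz_def const_xy_def of_x_def)

  \<comment> \<open>Absorbing \<open>v1\<close> into \<open>k\<close> lets the reduced system be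
    solved before \<open>v1\<close> is known to be nonzero.\<close>
  define k where "k = const_xy v1 * h"
  have ky: "pderiv k = const_xy v1 * hy" and kx: "map_poly pderiv k = const_xy v1 * hx"
    unfolding k_def dy.mult dx.mult by (simp_all add: const_xy_def of_x_def hx_def hy_def)
  have k0: "eval_xy k 0 0 = 0" using H0(3) by (simp add: k_def)
  have jac: "map_poly pderiv u * pderiv k = pderiv u * map_poly pderiv k"
  proof -
    have "vz = [:const_xy v1:]" by (simp add: vz_def v pderiv_pCons)
    hence "const_xy v1 * (ux * hy - uy * hx) = 0" using det by auto
    thus ?thesis unfolding ky kx by (simp add: ux_def uy_def algebra_simps)
  qed
  have min': "map_poly pderiv u ^ 2 + pderiv u * map_poly pderiv w + pderiv k = 0"
    using minors_coeff[of 0] by (simp add: ky ux_def uy_def w_def v1[simplified])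
  have tr': "pderiv w = - map_poly pderiv u" using dy_v[of 0] by (simp add: w_def ux_def)
  obtain b0 b1 l where slope: "map_poly pderiv u = [:[:b0, 2 * b1:]:] * pderiv u"
    and k: "k = const_xy b1 * u ^ 2 + const_xy l * u"
    and w: "w = - ([:[:b0, 2 * b1:]:] * u) - const_xy l * [:[:0, 1:]:]"
    using reduced_system[OF uy[unfolded uy_def] H0(1) k0 w0 jac min' tr'] .

  \<comment> \<open>Otherwise \<open>k = 0\<close>, and the quadratic formula for \<open>k\<close>
    forces \<open>b1 = l = 0\<close>; then \<open>v = - b0 u\<close>, against independence.\<close>
  have "v1 \<noteq> 0"
  proof
    assume [simp]: "v1 = 0"
    have "u * (const_xy b1 * u + const_xy l) = 0"
      using k unfolding k_def by (simp add: const_xy_def of_x_def power2_eq_square algebra_simps)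
    hence *: "const_xy b1 * u + const_xy l = 0" using u_neq by (simp only: mult_eq_0_iff) simp
    have "const_xy b1 * uy = 0"
      using arg_cong[OF *, of pderiv] unfolding dy.add dy.mult
      by (simp add: const_xy_def of_x_def uy_def)
    hence "b1 = 0" using uy by (simp add: const_xy_def of_x_def)
    moreover from this have "l = 0" using * by (simp add: const_xy_def of_x_def)
    ultimately have "v = [:- (const_xy b0 * u):]"
      unfolding v w by (simp add: const_xy_def of_x_def)
    hence "const_xyz b0 * of_xy u + const_xyz 1 * v + const_xyz 0 * of_xy h = 0"
      by (simp add: const_xyz_def of_xy_def const_xy_def of_x_def flip: smult_add_left)
    thus False using lin by fastforce
  qed
  define c0 where "c0 = b1 / v1"
  define l2 where "l2 = l / v1"
  have h: "h = const_xy c0 * u ^ 2 + const_xy l2 * u"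
  proof -
    have "const_xy (inverse v1) * k = h"
      using \<open>v1 \<noteq> 0\<close> by (simp add: k_def const_xy_def of_x_def)
    thus ?thesis
      unfolding k by (simp add: const_xy_def of_x_def c0_def l2_def smult_add_right divide_inverse mult.commute)
  qed
  have "c0 \<noteq> 0"
  proof
    assume "c0 = 0"
    hence "h = const_xy l2 * u" using h by (simp add: const_xy_def of_x_def)
    thus False using h_neq by blast
  qed
  \<comment> \<open>The primitive of the slope is taken without constant term, so that
    \<open>u(0,0) = 0\<close> becomes \<open>poly g 0 = 0\<close>.\<close>
  define b where "b = [:0, b0, b1:]"
  have db: "pderiv b = [:b0, 2 * b1:]" by (simp add: b_def pderiv_pCons)
  obtain g where g: "u = subst_xy g [:b, 1:]"
    using exists_subst_of_slope[OF slope[folded db]] .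
  have arg: "const_xy 1 * Y_xy + of_x b = [:b, 1:]"
    by (simp add: const_xy_def of_x_def Y_xy_def)
  have "poly g 0 = 0"
    using H0(1) unfolding g eval_xy_subst_xy by (simp add: eval_xy_def b_def)
  have "degree g \<ge> 1"
  proof (rule ccontr)
    assume "\<not> degree g \<ge> 1"
    then obtain c where "g = [:c:]" by (metis One_nat_def Suc_leI degree_eq_zeroE not_gr0)
    hence "u = const_xy c" using g by (simp add: subst_xy_def Polynomial.map_poly_pCons const_xy_def of_x_def)
    thus False using uy by (simp add: uy_def const_xy_def of_x_def)
  qed
  have v': "v = const_xyz v1 * Z_xyz - of_xy (const_xy (inverse 1) * of_x (pderiv b) * u)
      - const_xyz (v1 * l2) * X_xyz"
    using \<open>v1 \<noteq> 0\<close>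
    by (simp add: v w db const_xyz_def Z_xyz_def of_xy_def const_xy_def of_x_def X_xyz_def X_xy_def l2_def)
  have b: "b = [:0, b0, v1 * c0 * 1:]" using \<open>v1 \<noteq> 0\<close> by (simp add: b_def c0_def)
  show ?thesis
  \<comment> \<open>The normalisation is \<open>a = 1\<close> and zero constant term in
    \<open>b\<close>; \<open>b0\<close> serves as \<open>l1\<close>.\<close>
  proof (rule exI[of _ v1], rule exI[of _ c0], rule exI[of _ 1], rule exI[of _ b0],
      rule exI[of _ l2], rule exI[of _ 0], rule exI[of _ b], rule exI[of _ g],
      unfold arg g[symmetric], intro conjI)
  qed (fact \<open>v1 \<noteq> 0\<close> \<open>c0 \<noteq> 0\<close> one_neq_zero b \<open>poly g 0 = 0\<close> \<open>degree g \<ge> 1\<close> refl v' h)+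
qed

end
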